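(* Let $r\ge 1$ and let $n_1\le n_2\le\dots\le n_r$ be positive integers, $\bar n=(n_1,\dots,n_r)$. Let $$\text{d-}P_{\bar n}=\frac{S_{\min}^{n_1}\times\cdots\times S_{\min}^{n_r}}{(x_1,\dots,x_r)\sim(-x_1,\dots,-x_r)}$$ be the digital projective product space. Then its digital Lusternik–Schnirelmann category satisfies $$\text{d-cat}(\text{d-}P_{\bar n})\le n_1+r-1 .$$
   Context: Digital images: a digital image is a set $X$ (typically a finite subset of some $\mathbb Z^N$) with an adjacency relation (symmetric, irreflexive). Throughout, a subset of $\mathbb Z^N$ carries the maximal adjacency $c_N$: distinct $x,y$ are adjacent iff $|x_i-y_i|\le 1$ for all $i$. In a Cartesian product of digital images, two distinct points are adjacent iff in each coordinate they are equal or adjacent. In a quotient of a digital image by an equivalence relation, two distinct classes are adjacent iff they have adjacent representatives. Continuity: a subset $U$ is connected if any two of its points are joined by a finite sequence in $U$ of consecutively adjacent points. A map $f:X\to Y$ of digital images is digitally continuous if it sends connected subsets to connected subsets (equivalently, adjacent points go to equal or adjacent points). Let $I_m=\{0,1,\dots,m\}\subset\mathbb Z$ with consecutive integers adjacent. Homotopy: digitally continuous maps $f,g:X\to Y$ are digitally homotopic if for some positive integer $m$ there is $H:X\times I_m\to Y$ with $H(x,0)=f(x)$ and $H(x,m)=g(x)$ for all $x\in X$, such that $t\mapsto H(x,t)$ is digitally continuous on $I_m$ for each $x$, and $x\mapsto H(x,t)$ is digitally continuous on $X$ for each $t$. A map is digitally nullhomotopic if it is digitally homotopic to a constant map. Digital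 LS-category: $\text{d-cat}(X)$ is the least integer $l$ such that $X$ is covered by $l+1$ subsets $U_0,\dots,U_l$ for which each inclusion $U_i\hookrightarrow X$ is digitally nullhomotopic in $X$. Minimal digital sphere: $S_{\min}^n\subset\mathbb Z^{n+1}$ is the set of the $2n+2$ points $\pm e_0,\dots,\pm e_n$, where $e_i$ are the standard basis vectors. Thus any two distinct points are adjacent except antipodal pairs $e_i,-e_i$. *)

theory Defs
  imports Main "HOL-Library.FuncSet" "HOL-Library.Extended_Nat"
begin

section \<open>Digital images\<close>

record 'a digital_image =
  pts :: "'a set"
  adj :: "'a \<Rightarrow> 'a \<Rightarrow> bool"

definition is_digital_image :: "'a digital_image \<Rightarrow> bool" where
  "is_digital_image X \<longleftrightarrow>
     (\<forall>x\<in>pts X. \<not> adj X x x) \<and> (\<forall>x\<in>pts X. \<forall>y\<in>pts X. adj X x y \<longrightarrow> adj X y x)"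

definition subimage :: "'a digital_image \<Rightarrow> 'a set \<Rightarrow> 'a digital_image" where
  "subimage X U = \<lparr>pts = U, adj = adj X\<rparr>"

text \<open>Points of $\mathbb{Z}^N$ are the extensional functions on \<open>{..<N}\<close>.\<close>

definition c_adj :: "nat \<Rightarrow> (nat \<Rightarrow> int) \<Rightarrow> (nat \<Rightarrow> int) \<Rightarrow> bool" where
  "c_adj N x y \<longleftrightarrow> x \<noteq> y \<and> (\<forall>i<N. \<bar>x i - y i\<bar> \<le> 1)"

definition lattice_image :: "nat \<Rightarrow> (nat \<Rightarrow> int) set \<Rightarrow> (nat \<Rightarrow> int) digital_image" where
  "lattice_image N A = \<lparr>pts = A, adj = c_adj N\<rparr>"

definition product_image :: "'i set \<Rightarrow> ('i \<Rightarrow> 'a digital_image) \<Rightarrow> ('i \<Rightarrow> 'a) digital_image" where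
  "product_image I X =
     \<lparr>pts = (\<Pi>\<^sub>E i\<in>I. pts (X i)),
      adj = (\<lambda>x y. x \<noteq> y \<and> (\<forall>i\<in>I. x i = y i \<or> adj (X i) (x i) (y i)))\<rparr>"

definition quotient_image :: "'a digital_image \<Rightarrow> ('a \<times> 'a) set \<Rightarrow> 'a set digital_image" where
  "quotient_image X R =
     \<lparr>pts = pts X // R,
      adj = (\<lambda>C D. C \<noteq> D \<and> (\<exists>x\<in>C. \<exists>y\<in>D. adj X x y))\<rparr>"

definition int_interval :: "nat \<Rightarrow> int digital_image" where
  "int_interval m = \<lparr>pts = {0..int m}, adj = (\<lambda>s t. \<bar>s - t\<bar> = 1)\<rparr>"


section \<open>Continuity, homotopy and category\<close>

definition dig_connected :: "'a digital_image \<Rightarrow> 'a set \<Rightarrow> bool" where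
  "dig_connected X U \<longleftrightarrow>
     (\<forall>x\<in>U. \<forall>y\<in>U. \<exists>p. p \<noteq> [] \<and> hd p = x \<and> last p = y \<and> set p \<subseteq> U \<and> successively (adj X) p)"

definition dig_continuous :: "'a digital_image \<Rightarrow> 'b digital_image \<Rightarrow> ('a \<Rightarrow> 'b) \<Rightarrow> bool" where
  "dig_continuous X Y f \<longleftrightarrow>
     f \<in> pts X \<rightarrow> pts Y \<and>
     (\<forall>U. U \<subseteq> pts X \<and> dig_connected X U \<longrightarrow> dig_connected Y (f ` U))"

text \<open>Continuity of the homotopy is only required in each variable separately.\<close>

definition dig_homotopic ::
  "'a digital_image \<Rightarrow> 'b digital_image \<Rightarrow> ('a \<Rightarrow> 'b) \<Rightarrow> ('a \<Rightarrow> 'b) \<Rightarrow> bool" where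
  "dig_homotopic X Y f g \<longleftrightarrow>
     dig_continuous X Y f \<and> dig_continuous X Y g \<and>
     (\<exists>m>0. \<exists>H.
        (\<forall>x\<in>pts X. H x 0 = f x \<and> H x (int m) = g x) \<and>
        (\<forall>x\<in>pts X. dig_continuous (int_interval m) Y (\<lambda>t. H x t)) \<and>
        (\<forall>t\<in>pts (int_interval m). dig_continuous X Y (\<lambda>x. H x t)))"

definition dig_nullhomotopic :: "'a digital_image \<Rightarrow> 'b digital_image \<Rightarrow> ('a \<Rightarrow> 'b) \<Rightarrow> bool" where
  "dig_nullhomotopic X Y f \<longleftrightarrow> (\<exists>c\<in>pts Y. dig_homotopic X Y f (\<lambda>_. c))"

text \<open>The value is \<open>\<infinity>\<close> if there is no finite categorical cover.\<close>

definition d_cat :: "'a digital_image \<Rightarrow> enat" where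
  "d_cat X = Inf {enat l | l. \<exists>U :: nat \<Rightarrow> 'a set.
     pts X = (\<Union>i\<in>{..l}. U i) \<and>
     (\<forall>i\<le>l. dig_nullhomotopic (subimage X (U i)) X (\<lambda>x. x))}"


section \<open>Digital projective product spaces\<close>

definition std_basis :: "nat \<Rightarrow> nat \<Rightarrow> (nat \<Rightarrow> int)" where
  "std_basis N i = (\<lambda>j\<in>{..<N}. if j = i then 1 else 0)"

definition vec_neg :: "nat \<Rightarrow> (nat \<Rightarrow> int) \<Rightarrow> (nat \<Rightarrow> int)" where
  "vec_neg N x = (\<lambda>j\<in>{..<N}. - x j)"

definition S_min :: "nat \<Rightarrow> (nat \<Rightarrow> int) digital_image" where
  "S_min n = lattice_image (n + 1)
     (\<Union>i\<in>{0..n}. {std_basis (n + 1) i, vec_neg (n + 1) (std_basis (n + 1) i)})"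

definition S_min_product :: "nat \<Rightarrow> (nat \<Rightarrow> nat) \<Rightarrow> (nat \<Rightarrow> nat \<Rightarrow> int) digital_image" where
  "S_min_product r n = product_image {1..r} (\<lambda>k. S_min (n k))"

definition product_neg :: "nat \<Rightarrow> (nat \<Rightarrow> nat) \<Rightarrow> (nat \<Rightarrow> nat \<Rightarrow> int) \<Rightarrow> (nat \<Rightarrow> nat \<Rightarrow> int)" where
  "product_neg r n x = (\<lambda>k\<in>{1..r}. vec_neg (n k + 1) (x k))"

definition antipodal_rel ::
  "nat \<Rightarrow> (nat \<Rightarrow> nat) \<Rightarrow> ((nat \<Rightarrow> nat \<Rightarrow> int) \<times> (nat \<Rightarrow> nat \<Rightarrow> int)) set" where
  "antipodal_rel r n =
     {(x, y). x \<in> pts (S_min_product r n) \<and> (y = x \<or> y = product_neg r n x)}"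

definition d_proj_product :: "nat \<Rightarrow> (nat \<Rightarrow> nat) \<Rightarrow> (nat \<Rightarrow> nat \<Rightarrow> int) set digital_image" where
  "d_proj_product r n = quotient_image (S_min_product r n) (antipodal_rel r n)"


section \<open>Well-definedness\<close>

lemma vec_neg_std_basis:
  "vec_neg N (vec_neg N (std_basis N i)) = std_basis N i"
  by (auto simp: vec_neg_def std_basis_def)

lemma vec_neg_S_min:
  assumes "x \<in> pts (S_min n)"
  shows "vec_neg (n + 1) x \<in> pts (S_min n)" "vec_neg (n + 1) (vec_neg (n + 1) x) = x"
proof -
  from assms obtain i where "i \<le> n"
    "x = std_basis (n + 1) i \<or> x = vec_neg (n + 1) (std_basis (n + 1) i)"
    by (auto simp: S_min_def lattice_image_def)
  then show "vec_neg (n + 1) x \<in> pts (S_min n)" "vec_neg (n + 1) (vec_neg (n + 1) x) = x"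
    by (auto simp: S_min_def lattice_image_def vec_neg_std_basis simp del: Suc_eq_plus1 One_nat_def add_Suc_right)
qed

lemma product_neg_S_min_product:
  assumes "x \<in> pts (S_min_product r n)"
  shows "product_neg r n x \<in> pts (S_min_product r n)"
    and "product_neg r n (product_neg r n x) = x"
proof -
  have x: "x k \<in> pts (S_min (n k))" if "k \<in> {1..r}" for k
    using assms that by (auto simp: S_min_product_def product_image_def)
  show "product_neg r n x \<in> pts (S_min_product r n)"
    using vec_neg_S_min(1)[OF x] by (auto simp: S_min_product_def product_image_def product_neg_def)
  have ext: "x \<in> extensional {1..r}"
    using assms by (auto simp: S_min_product_def product_image_def PiE_def)
  show "product_neg r n (product_neg r n x) = x"
  proof
    fix k
    show "product_neg r n (product_neg r n x) k = x k"
      using vec_neg_S_min(2)[OF x, of k] ext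
      by (cases "k \<in> {1..r}") (auto simp: product_neg_def extensional_def)
  qed
qed

lemma equiv_antipodal_rel: "equiv (pts (S_min_product r n)) (antipodal_rel r n)"
  by (rule equivI)
    (auto simp: antipodal_rel_def refl_on_def sym_def trans_def product_neg_S_min_product)

lemma is_digital_image_S_min: "is_digital_image (S_min n)"
  by (auto simp: is_digital_image_def S_min_def lattice_image_def c_adj_def abs_minus_commute)

lemma is_digital_image_d_proj_product: "is_digital_image (d_proj_product r n)"
proof -
  have sym: "adj (S_min_product r n) x y \<Longrightarrow> adj (S_min_product r n) y x" for x y
    by (auto simp: S_min_product_def product_image_def S_min_def lattice_image_def c_adj_def
        abs_minus_commute)
  then show ?thesis
    by (auto simp: is_digital_image_def d_proj_product_def quotient_image_def)
qed

end

theory Submission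
  imports Defs
begin

text \<open>
  The bound holds because \<open>d_cat\<close> is in fact 0. If a digital image has a clique \<open>K\<close> that dominates it,
  i.e. every point is equal or adjacent to some point of \<open>K\<close>, then moving each point to such a
  neighbour in \<open>K\<close> and then to one fixed point of \<open>K\<close> is a homotopy from the identity to a constant:
  continuity is only required in each variable separately, and every map into a clique is continuous.
  For \<open>n \<ge> 1\<close> the pair \<open>e\<^sub>0, e\<^sub>1\<close> is a dominating clique of the minimal \<open>n\<close>-sphere, because no point is
  antipodal to both, and dominating cliques are inherited by products and quotients.
\<close>

definition dominating_clique :: "'a digital_image \<Rightarrow> 'a set \<Rightarrow> bool" where
  "dominating_clique X K \<longleftrightarrow>
     K \<subseteq> pts X \<and> K \<noteq> {} \<and>
     (\<forall>x\<in>K. \<forall>y\<in>K. x = y \<or> adj X x y) \<and>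
     (\<forall>x\<in>pts X. \<exists>y\<in>K. x = y \<or> adj X x y)"

text \<open>A map may send adjacent points to one point, so the image of a path can stall; dropping
  consecutive repetitions makes it a genuine path again.\<close>

lemma successively_remdups_adj:
  assumes "successively (\<lambda>x y. x = y \<or> P x y) p"
  shows "successively P (remdups_adj p)"
  using assms by (induction p rule: remdups_adj.induct) (auto simp: successively_Cons)

text \<open>Reduces continuity to adjacent pairs: a path inside \<open>U\<close> is mapped to a
  possibly stalling path inside the image of \<open>U\<close>, and \<open>remdups_adj\<close> keeps
  both of its endpoints.\<close>

lemma dig_continuousI:
  assumes "f \<in> pts X \<rightarrow> pts Y"
    and "\<And>x y. x \<in> pts X \<Longrightarrow> y \<in> pts X \<Longrightarrow> adj X x y \<Longrightarrow> f x = f y \<or> adj Y (f x) (f y)"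
  shows "dig_continuous X Y f"
proof -
  have "dig_connected Y (f ` U)" if U: "U \<subseteq> pts X" "dig_connected X U" for U
    unfolding dig_connected_def
  proof (intro ballI, elim imageE, hypsubst)
    fix x y assume "x \<in> U" "y \<in> U"
    with U obtain p where p: "p \<noteq> []" "hd p = x" "last p = y" "set p \<subseteq> U" "successively (adj X) p"
      unfolding dig_connected_def by blast
    have "successively (\<lambda>x y. f x = f y \<or> adj Y (f x) (f y)) p"
      using p(5) by (rule successively_mono) (use p(4) U(1) assms(2) in blast)
    then have "successively (adj Y) (remdups_adj (map f p))"
      by (intro successively_remdups_adj) (simp add: successively_map)
    then show "\<exists>q. q \<noteq> [] \<and> hd q = f x \<and> last q = f y \<and> set q \<subseteq> f ` U \<and> successively (adj Y) q"
      using p by (intro exI[of _ "remdups_adj (map f p)"]) (auto simp: hd_map last_map)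
  qed
  with assms(1) show ?thesis
    by (simp add: dig_continuous_def)
qed

lemma dominating_clique_nullhomotopic:
  assumes X: "is_digital_image X" and K: "dominating_clique X K"
  shows "dig_nullhomotopic X X (\<lambda>x. x)"
proof -
  have KX: "K \<subseteq> pts X" and clique: "\<And>x y. x \<in> K \<Longrightarrow> y \<in> K \<Longrightarrow> x = y \<or> adj X x y"
    using K by (auto simp: dominating_clique_def)
  obtain c where c: "c \<in> K"
    using K by (auto simp: dominating_clique_def)
  obtain g where g: "\<And>x. x \<in> pts X \<Longrightarrow> g x \<in> K" "\<And>x. x \<in> pts X \<Longrightarrow> x = g x \<or> adj X x (g x)"
    using K unfolding dominating_clique_def by metis
  have sym: "adj X y x" if "adj X x y" "x \<in> pts X" "y \<in> pts X" for x y
    using X that by (auto simp: is_digital_image_def)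
  \<comment> \<open>Time 0 is the identity, time 1 the move into \<open>K\<close>, time 2 the
    constant \<open>c\<close>; hence the homotopy has length 2.\<close>
  define H where "H x t = (if t = 0 then x else if t = 1 then g x else c)" for x and t :: int
  have id: "dig_continuous X X (\<lambda>x. x)"
    by (rule dig_continuousI) auto
  have const: "dig_continuous X X (\<lambda>_. c)"
    using c KX by (intro dig_continuousI) auto
  \<comment> \<open>An arbitrary choice of neighbours suffices, since any two values of
    \<open>g\<close> lie in the clique.\<close>
  have gcont: "dig_continuous X X g"
    using g(1) KX by (intro dig_continuousI) (auto dest!: clique)
  have Ht: "dig_continuous (int_interval 2) X (H x)" if x: "x \<in> pts X" for x
  proof (rule dig_continuousI)
    show "H x \<in> pts (int_interval 2) \<rightarrow> pts X"
      using x g(1)[OF x] c KX by (auto simp: H_def)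
  next
    fix s t assume "s \<in> pts (int_interval 2)" "t \<in> pts (int_interval 2)"
      and "adj (int_interval 2) s t"
    then have "s = 0 \<and> t = 1 \<or> s = 1 \<and> t = 0 \<or> s = 1 \<and> t = 2 \<or> s = 2 \<and> t = 1"
      by (simp add: int_interval_def) arith
    \<comment> \<open>Time steps occur in both directions, so the move from \<open>x\<close> to
      \<open>g x\<close> is also needed reversed.\<close>
    moreover have "g x = x \<or> adj X (g x) x"
      using g[OF x] sym x KX by (metis subsetD)
    ultimately show "H x s = H x t \<or> adj X (H x s) (H x t)"
      using g(2)[OF x] clique[OF g(1)[OF x] c] clique[OF c g(1)[OF x]]
      by (auto simp: H_def)
  qed
  have Hx: "dig_continuous X X (\<lambda>x. H x t)" for t
    using id const gcont by (cases "t = 0"; cases "t = 1") (simp_all add: H_def)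
  have "dig_homotopic X X (\<lambda>x. x) (\<lambda>_. c)"
    unfolding dig_homotopic_def
    using id const Ht Hx by (intro conjI exI[of _ "2::nat"] exI[of _ H]) (auto simp: H_def)
  then show ?thesis
    using c KX by (auto simp: dig_nullhomotopic_def)
qed

lemma dig_nullhomotopic_subimage_pts:
  "dig_nullhomotopic (subimage X (pts X)) Y f \<longleftrightarrow> dig_nullhomotopic X Y f"
  by (simp add: dig_nullhomotopic_def dig_homotopic_def dig_continuous_def dig_connected_def
      subimage_def)

text \<open>The single set \<open>pts X\<close> is a categorical cover, which is the case
  \<open>l = 0\<close>.\<close>

lemma d_cat_eq_0:
  assumes "dig_nullhomotopic X X (\<lambda>x. x)"
  shows "d_cat X = 0"
proof -
  have "d_cat X \<le> enat 0"
    unfolding d_cat_def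
    using assms
    by (intro Inf_lower CollectI exI[of _ "0::nat"] conjI refl exI[of _ "\<lambda>_. pts X"])
      (simp_all add: dig_nullhomotopic_subimage_pts)
  then show ?thesis
    by (simp add: zero_enat_def[symmetric])
qed

text \<open>Being equal or adjacent in a product is tested coordinate by coordinate, so neighbours
  can be chosen independently in each factor.\<close>

lemma dominating_clique_product:
  assumes "\<And>i. i \<in> I \<Longrightarrow> dominating_clique (X i) (K i)"
  shows "dominating_clique (product_image I X) (\<Pi>\<^sub>E i\<in>I. K i)"
proof -
  have KX: "K i \<subseteq> pts (X i)" and ne: "K i \<noteq> {}"
    and clique: "\<And>x y. x \<in> K i \<Longrightarrow> y \<in> K i \<Longrightarrow> x = y \<or> adj (X i) x y"
    and dom: "\<And>x. x \<in> pts (X i) \<Longrightarrow> \<exists>y\<in>K i. x = y \<or> adj (X i) x y"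
    if "i \<in> I" for i
    using assms[OF that] by (simp_all add: dominating_clique_def)
  have "\<exists>y\<in>\<Pi>\<^sub>E i\<in>I. K i. x = y \<or> adj (product_image I X) x y"
    if x: "x \<in> pts (product_image I X)" for x
  proof -
    have "\<forall>i\<in>I. \<exists>y. y \<in> K i \<and> (x i = y \<or> adj (X i) (x i) y)"
      using dom x by (fastforce simp: product_image_def)
    then obtain y where "\<forall>i\<in>I. y i \<in> K i \<and> (x i = y i \<or> adj (X i) (x i) (y i))"
      by metis
    then show ?thesis
      \<comment> \<open>Restricting to \<open>I\<close> makes the chosen neighbour extensional, as
        membership in \<open>PiE\<close> demands.\<close>
      by (intro bexI[of _ "restrict y I"]) (auto simp: product_image_def)
  qed
  moreover have "(\<Pi>\<^sub>E i\<in>I. K i) \<subseteq> pts (product_image I X)"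
    using KX by (auto simp: product_image_def PiE_iff)
  moreover have "(\<Pi>\<^sub>E i\<in>I. K i) \<noteq> {}"
    using ne by (simp add: PiE_eq_empty_iff)
  moreover have "\<forall>x\<in>\<Pi>\<^sub>E i\<in>I. K i. \<forall>y\<in>\<Pi>\<^sub>E i\<in>I. K i. x = y \<or> adj (product_image I X) x y"
    using clique by (fastforce simp: product_image_def PiE_iff)
  ultimately show ?thesis
    unfolding dominating_clique_def by blast
qed

lemma dominating_clique_quotient:
  assumes R: "equiv (pts X) R" and K: "dominating_clique X K"
  shows "dominating_clique (quotient_image X R) ((\<lambda>x. R `` {x}) ` K)"
proof -
  \<comment> \<open>The projection preserves being equal or adjacent: \<open>x\<close> and
    \<open>y\<close> themselves are the adjacent representatives when their classes differ.\<close>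
  have *: "R `` {x} = R `` {y} \<or> adj (quotient_image X R) (R `` {x}) (R `` {y})"
    if "x \<in> pts X" "y \<in> pts X" "x = y \<or> adj X x y" for x y
    using that equiv_class_self[OF R] by (auto simp: quotient_image_def)
  have KX: "K \<subseteq> pts X"
    using K by (simp add: dominating_clique_def)
  have "\<exists>D\<in>(\<lambda>x. R `` {x}) ` K. C = D \<or> adj (quotient_image X R) C D"
    if "C \<in> pts (quotient_image X R)" for C
  proof -
    from that obtain x where x: "x \<in> pts X" "C = R `` {x}"
      by (auto simp: quotient_image_def elim: quotientE)
    obtain y where "y \<in> K" "x = y \<or> adj X x y"
      using K x(1) unfolding dominating_clique_def by blast
    with * x KX show ?thesis
      by blast
  qed
  moreover have "(\<lambda>x. R `` {x}) ` K \<subseteq> pts (quotient_image X R)"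
    using KX by (auto simp: quotient_image_def intro: quotientI)
  moreover have "\<forall>C\<in>(\<lambda>x. R `` {x}) ` K. \<forall>D\<in>(\<lambda>x. R `` {x}) ` K.
      C = D \<or> adj (quotient_image X R) C D"
    using K KX * unfolding dominating_clique_def by blast
  moreover have "(\<lambda>x. R `` {x}) ` K \<noteq> {}"
    using K by (simp add: dominating_clique_def)
  ultimately show ?thesis
    unfolding dominating_clique_def by blast
qed

lemma dominating_clique_S_min:
  assumes "n \<ge> 1"
  shows "dominating_clique (S_min n) {std_basis (n + 1) 0, std_basis (n + 1) 1}"
proof -
  have pos: "u = v \<or> adj (S_min n) u v"
    if "u = std_basis (n + 1) i" "v = std_basis (n + 1) j" for u v i j
    using that by (auto simp: S_min_def lattice_image_def c_adj_def std_basis_def)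
  \<comment> \<open>The supports of -e_i and e_j are disjoint, so no coordinate differs by more than
    1. The bound \<open>j \<le> n\<close> keeps \<open>j\<close> among the coordinates, where the
    values 0 and 1 tell the two vectors apart.\<close>
  have neg: "adj (S_min n) (vec_neg (n + 1) (std_basis (n + 1) i)) (std_basis (n + 1) j)"
    if "i \<noteq> j" "j \<le> n" for i j
  proof -
    have "vec_neg (n + 1) (std_basis (n + 1) i) j \<noteq> std_basis (n + 1) j j"
      using that by (simp add: vec_neg_def std_basis_def)
    then have "vec_neg (n + 1) (std_basis (n + 1) i) \<noteq> std_basis (n + 1) j"
      by metis
    moreover have "\<bar>vec_neg (n + 1) (std_basis (n + 1) i) k - std_basis (n + 1) j k\<bar> \<le> 1"
      if "k < n + 1" for k
      using that \<open>i \<noteq> j\<close> by (simp add: vec_neg_def std_basis_def)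
    ultimately show ?thesis
      by (simp add: S_min_def lattice_image_def c_adj_def)
  qed
  have pts: "pts (S_min n) =
      (\<Union>i\<in>{0..n}. {std_basis (n + 1) i, vec_neg (n + 1) (std_basis (n + 1) i)})"
    by (simp add: S_min_def lattice_image_def)
  let ?K = "{std_basis (n + 1) 0, std_basis (n + 1) 1}"
  have "\<exists>v\<in>?K. u = v \<or> adj (S_min n) u v" if u: "u \<in> pts (S_min n)" for u
  proof -
    from u consider i where "u = std_basis (n + 1) i"
      | i where "u = vec_neg (n + 1) (std_basis (n + 1) i)"
      unfolding pts by blast
    then show ?thesis
    proof cases
      case 1
      then show ?thesis using pos by blast
    next
      case 2
      then show ?thesis
        \<comment> \<open>The point -e_0 is adjacent to e_1, every other -e_i to e_0.\<close>
        using neg[of i 0] neg[of i 1] assms by (cases "i = 0") auto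
    qed
  qed
  moreover have "?K \<subseteq> pts (S_min n)"
    unfolding pts using assms by auto
  moreover have "\<forall>u\<in>?K. \<forall>v\<in>?K. u = v \<or> adj (S_min n) u v"
    using pos by blast
  ultimately show ?thesis
    unfolding dominating_clique_def by blast
qed

theorem theorem3p2:
  fixes r :: nat and n :: "nat \<Rightarrow> nat"
  assumes "r \<ge> 1"
    and "\<And>k. k \<in> {1..r} \<Longrightarrow> n k \<ge> 1"
    and "mono_on {1..r} n"
  shows "d_cat (d_proj_product r n) \<le> enat (n 1 + r - 1)"
proof -
  \<comment> \<open>All tuples with entries e_0 or e_1; their antipodal classes dominate the
    quotient.\<close>
  define K where
    "K = (\<Pi>\<^sub>E k\<in>{1..r}. {std_basis (n k + 1) 0, std_basis (n k + 1) 1})"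
  have "dominating_clique (S_min_product r n) K"
    unfolding S_min_product_def K_def
    by (intro dominating_clique_product dominating_clique_S_min assms(2))
  then have "dominating_clique (d_proj_product r n) ((\<lambda>x. antipodal_rel r n `` {x}) ` K)"
    unfolding d_proj_product_def by (rule dominating_clique_quotient[OF equiv_antipodal_rel])
  then have "d_cat (d_proj_product r n) = 0"
    by (intro d_cat_eq_0 dominating_clique_nullhomotopic[OF is_digital_image_d_proj_product])
  then show ?thesis
    by simp
qed

end
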